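(* For any set of rule schemes $\mathcal{R}\subseteq\{N,H,P,F,wF\}$ there exists a non-commutative spacetime $\mathcal{S}\in\mathbf{ST}(\mathcal{R})$ such that for every sequent, if $\mathcal{S}\vDash\Gamma\Rightarrow A$ then $\Gamma\vdash_{\mathbf{STL}(\mathcal{R})}A$. Likewise there exists a spacetime $\mathcal{S}\in i\mathbf{ST}(\mathcal{R})$ such that if $\mathcal{S}\vDash\Gamma\Rightarrow A$ then $\Gamma\vdash_{i\mathbf{STL}(\mathcal{R})}A$.
   Context: Formulas of $\mathcal{L}_\nabla$ are built from propositional variables and constants $1,\top,\bot$ by binary $\wedge,\vee,\otimes,\to$ and unary $\nabla$. A sequent is $\Gamma\Rightarrow A$ with $\Gamma$ a finite (possibly empty) sequence; $\nabla\Gamma$ applies $\nabla$ to each member. $\mathbf{STL}$ has axioms $A\Rightarrow A$, $\Rightarrow1$, $\nabla1\Rightarrow1$, $\Gamma\Rightarrow\top$, $\Gamma,\bot,\Sigma\Rightarrow A$ and rules (premises / conclusion): cut: $\Gamma\Rightarrow A$, $\Pi,A,\Sigma\Rightarrow B$ / $\Pi,\Gamma,\Sigma\Rightarrow B$; $L\wedge$: $\Gamma,A,\Sigma\Rightarrow C$ / $\Gamma,A\wedge B,\Sigma\Rightarrow C$ and $\Gamma,B,\Sigma\Rightarrow C$ / $\Gamma,A\wedge B,\Sigma\Rightarrow C$; $R\wedge$: $\Gamma\Rightarrow A$, $\Gamma\Rightarrow B$ / $\Gamma\Rightarrow A\wedge B$; $L\vee$: $\Gamma,A,\Sigma\Rightarrow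 C$, $\Gamma,B,\Sigma\Rightarrow C$ / $\Gamma,A\vee B,\Sigma\Rightarrow C$; $R\vee$: $\Gamma\Rightarrow A$ / $\Gamma\Rightarrow A\vee B$ and $\Gamma\Rightarrow B$ / $\Gamma\Rightarrow A\vee B$; $L1$: $\Gamma,\Sigma\Rightarrow A$ / $\Gamma,1,\Sigma\Rightarrow A$; $L\otimes$: $\Gamma,A,B,\Sigma\Rightarrow C$ / $\Gamma,A\otimes B,\Sigma\Rightarrow C$; $R\otimes$: $\Gamma\Rightarrow A$, $\Sigma\Rightarrow B$ / $\Gamma,\Sigma\Rightarrow A\otimes B$; $(\nabla)$: $A\Rightarrow B$ / $\nabla A\Rightarrow\nabla B$; Oplax: $\nabla A,\nabla B\Rightarrow C$ / $\nabla(A\otimes B)\Rightarrow C$; $L\to$: $\Gamma\Rightarrow A$, $\Pi,B,\Sigma\Rightarrow C$ / $\Pi,\Gamma,\nabla(A\to B),\Sigma\Rightarrow C$; $R\to$: $A,\nabla\Gamma\Rightarrow B$ / $\Gamma\Rightarrow A\to B$. Rule schemes: $(N)$: $\Gamma\Rightarrow A$ / $\nabla\Gamma\Rightarrow\nabla A$; $(P)$: $\Gamma\Rightarrow\nabla A$ / $\Gamma\Rightarrow A$; $(F)$: $\Gamma\Rightarrow A$ / $\Gamma\Rightarrow\nabla A$; $(wF)$: $\nabla A\Rightarrow\bot$ / $A\Rightarrow\bot$; $(H)$: $\Gamma,A_1\to B_1,\dots,A_n\to B_n\Rightarrow C$ / $\nabla\Gamma,\nabla A_1\to\nabla B_1,\dots,\nabla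 A_n\to\nabla B_n\Rightarrow\nabla C$ ($n\ge0$). Structural rules: weakening, contraction and exchange on the left of $\Rightarrow$. $\mathbf{STL}(\mathcal{R})$ is $\mathbf{STL}$ plus the schemes in $\mathcal{R}$; $i\mathbf{STL}(\mathcal{R})$ adds the structural rules; $\Gamma\vdash_L A$ means $L$ derives $\Gamma\Rightarrow A$. Semantics: a quantale is a monoidal poset (monoid with multiplication monotone in each argument) with all joins over which multiplication distributes; a locale is a quantale whose multiplication is binary meet with unit the top. A non-commutative spacetime is $\mathcal{S}=(\mathscr{X},\nabla)$ with $\mathscr{X}$ a quantale and $\nabla$ join preserving and oplax monoidal; a spacetime is one with $\mathscr{X}$ a locale. Its implication $\to_{\mathcal{S}}$ is characterized by $a\otimes\nabla b\le c$ iff $b\le a\to_{\mathcal{S}}c$. A valuation $V$ maps formulas to $\mathscr{X}$ with $V(1)=e$, $V(\bot)$ bottom, $V(\top)$ top, commuting with $\wedge,\vee,\otimes,\nabla,\to$ (meet, join, $\otimes$, $\nabla$, $\to_{\mathcal{S}}$). $\mathcal{S}\vDash\gamma_1,\dots,\gamma_n\Rightarrow A$ iff $V(\gamma_1)\otimes\cdots\otimes V(\gamma_n)\le V(A)$ for all $V$ (empty product $=e$). $\mathcal{S}$ satisfies $(N)$ if $\nabla e=e$ and $\nabla(a\otimes b)=\nabla a\otimes\nabla b$; $(H)$ if $\nabla$ preserves all structure including the implication; $(P)$ if $\nabla a\le a$; $(F)$ if $a\le\nabla a$; $(wF)$ if $\nabla a=0$ implies $a=0$. $\mathbf{ST}(\mathcal{R})$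 (resp. $i\mathbf{ST}(\mathcal{R})$) is the class of non-commutative spacetimes (resp. spacetimes) satisfying all schemes in $\mathcal{R}$. *)

theory Defs
  imports Main
begin

datatype fm =
    Var nat
  | One
  | Top
  | Bot
  | And fm fm
  | Or fm fm
  | Tens fm fm
  | Imp fm fm
  | Nab fm

datatype scheme = SN | SH | SP | SF | SwF

text \<open>derivable R s Gamma A: the sequent Gamma => A is derivable in STL(R);
  if s is True the structural rules (weakening, contraction, exchange on the left)
  are added, giving iSTL(R).\<close>

inductive derivable :: "scheme set \<Rightarrow> bool \<Rightarrow> fm list \<Rightarrow> fm \<Rightarrow> bool" for R s where
  ax: "derivable R s [A] A"
| one: "derivable R s [] One"
| nabone: "derivable R s [Nab One] One"
| top: "derivable R s \<Gamma> Top"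
| bot: "derivable R s (\<Gamma> @ [Bot] @ \<Sigma>) A"
| cut: "derivable R s \<Gamma> A \<Longrightarrow> derivable R s (\<Pi> @ [A] @ \<Sigma>) B
        \<Longrightarrow> derivable R s (\<Pi> @ \<Gamma> @ \<Sigma>) B"
| andL1: "derivable R s (\<Gamma> @ [A] @ \<Sigma>) C \<Longrightarrow> derivable R s (\<Gamma> @ [And A B] @ \<Sigma>) C"
| andL2: "derivable R s (\<Gamma> @ [B] @ \<Sigma>) C \<Longrightarrow> derivable R s (\<Gamma> @ [And A B] @ \<Sigma>) C"
| andR: "derivable R s \<Gamma> A \<Longrightarrow> derivable R s \<Gamma> B \<Longrightarrow> derivable R s \<Gamma> (And A B)"
| orL: "derivable R s (\<Gamma> @ [A] @ \<Sigma>) C \<Longrightarrow> derivable R s (\<Gamma> @ [B] @ \<Sigma>) C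
        \<Longrightarrow> derivable R s (\<Gamma> @ [Or A B] @ \<Sigma>) C"
| orR1: "derivable R s \<Gamma> A \<Longrightarrow> derivable R s \<Gamma> (Or A B)"
| orR2: "derivable R s \<Gamma> B \<Longrightarrow> derivable R s \<Gamma> (Or A B)"
| oneL: "derivable R s (\<Gamma> @ \<Sigma>) A \<Longrightarrow> derivable R s (\<Gamma> @ [One] @ \<Sigma>) A"
| tensL: "derivable R s (\<Gamma> @ [A, B] @ \<Sigma>) C \<Longrightarrow> derivable R s (\<Gamma> @ [Tens A B] @ \<Sigma>) C"
| tensR: "derivable R s \<Gamma> A \<Longrightarrow> derivable R s \<Sigma> B \<Longrightarrow> derivable R s (\<Gamma> @ \<Sigma>) (Tens A B)"
| nab: "derivable R s [A] B \<Longrightarrow> derivable R s [Nab A] (Nab B)"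
| oplax: "derivable R s [Nab A, Nab B] C \<Longrightarrow> derivable R s [Nab (Tens A B)] C"
| impL: "derivable R s \<Gamma> A \<Longrightarrow> derivable R s (\<Pi> @ [B] @ \<Sigma>) C
        \<Longrightarrow> derivable R s (\<Pi> @ \<Gamma> @ [Nab (Imp A B)] @ \<Sigma>) C"
| impR: "derivable R s (A # map Nab \<Gamma>) B \<Longrightarrow> derivable R s \<Gamma> (Imp A B)"
| ruleN: "SN \<in> R \<Longrightarrow> derivable R s \<Gamma> A \<Longrightarrow> derivable R s (map Nab \<Gamma>) (Nab A)"
| ruleP: "SP \<in> R \<Longrightarrow> derivable R s \<Gamma> (Nab A) \<Longrightarrow> derivable R s \<Gamma> A"
| ruleF: "SF \<in> R \<Longrightarrow> derivable R s \<Gamma> A \<Longrightarrow> derivable R s \<Gamma> (Nab A)"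
| rulewF: "SwF \<in> R \<Longrightarrow> derivable R s [Nab A] Bot \<Longrightarrow> derivable R s [A] Bot"
| ruleH: "SH \<in> R \<Longrightarrow> derivable R s (\<Gamma> @ map (\<lambda>(a, b). Imp a b) ps) C
        \<Longrightarrow> derivable R s (map Nab \<Gamma> @ map (\<lambda>(a, b). Imp (Nab a) (Nab b)) ps) (Nab C)"
| weak: "s \<Longrightarrow> derivable R s (\<Gamma> @ \<Sigma>) C \<Longrightarrow> derivable R s (\<Gamma> @ [A] @ \<Sigma>) C"
| contr: "s \<Longrightarrow> derivable R s (\<Gamma> @ [A, A] @ \<Sigma>) C \<Longrightarrow> derivable R s (\<Gamma> @ [A] @ \<Sigma>) C"
| exch: "s \<Longrightarrow> derivable R s (\<Gamma> @ [A, B] @ \<Sigma>) C \<Longrightarrow> derivable R s (\<Gamma> @ [B, A] @ \<Sigma>) C"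

record 'a stp =
  car :: "'a set"
  le :: "'a \<Rightarrow> 'a \<Rightarrow> bool"
  mul :: "'a \<Rightarrow> 'a \<Rightarrow> 'a"
  unit :: "'a"
  nab :: "'a \<Rightarrow> 'a"

definition is_lub :: "('a, 'b) stp_scheme \<Rightarrow> 'a set \<Rightarrow> 'a \<Rightarrow> bool" where
  "is_lub Q S x \<longleftrightarrow> x \<in> car Q \<and> (\<forall>y\<in>S. le Q y x)
      \<and> (\<forall>z\<in>car Q. (\<forall>y\<in>S. le Q y z) \<longrightarrow> le Q x z)"

definition join :: "('a, 'b) stp_scheme \<Rightarrow> 'a set \<Rightarrow> 'a" where
  "join Q S = (THE x. is_lub Q S x)"

definition is_glb :: "('a, 'b) stp_scheme \<Rightarrow> 'a set \<Rightarrow> 'a \<Rightarrow> bool" where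
  "is_glb Q S x \<longleftrightarrow> x \<in> car Q \<and> (\<forall>y\<in>S. le Q x y)
      \<and> (\<forall>z\<in>car Q. (\<forall>y\<in>S. le Q z y) \<longrightarrow> le Q z x)"

definition meet :: "('a, 'b) stp_scheme \<Rightarrow> 'a \<Rightarrow> 'a \<Rightarrow> 'a" where
  "meet Q a b = (THE x. is_glb Q {a, b} x)"

definition topQ :: "('a, 'b) stp_scheme \<Rightarrow> 'a" where
  "topQ Q = join Q (car Q)"

definition botQ :: "('a, 'b) stp_scheme \<Rightarrow> 'a" where
  "botQ Q = join Q {}"

definition quantale :: "('a, 'b) stp_scheme \<Rightarrow> bool" where
  "quantale Q \<longleftrightarrow>
     (\<forall>a\<in>car Q. le Q a a)
   \<and> (\<forall>a\<in>car Q. \<forall>b\<in>car Q. le Q a b \<and> le Q b a \<longrightarrow> a = b)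
   \<and> (\<forall>a\<in>car Q. \<forall>b\<in>car Q. \<forall>c\<in>car Q. le Q a b \<and> le Q b c \<longrightarrow> le Q a c)
   \<and> unit Q \<in> car Q
   \<and> (\<forall>a\<in>car Q. \<forall>b\<in>car Q. mul Q a b \<in> car Q)
   \<and> (\<forall>a\<in>car Q. \<forall>b\<in>car Q. \<forall>c\<in>car Q. mul Q (mul Q a b) c = mul Q a (mul Q b c))
   \<and> (\<forall>a\<in>car Q. mul Q (unit Q) a = a \<and> mul Q a (unit Q) = a)
   \<and> (\<forall>a\<in>car Q. \<forall>b\<in>car Q. \<forall>c\<in>car Q. le Q a b \<longrightarrow>
        le Q (mul Q a c) (mul Q b c) \<and> le Q (mul Q c a) (mul Q c b))
   \<and> (\<forall>S\<subseteq>car Q. \<exists>x. is_lub Q S x)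
   \<and> (\<forall>a\<in>car Q. \<forall>S\<subseteq>car Q.
        mul Q a (join Q S) = join Q ((\<lambda>s. mul Q a s) ` S)
      \<and> mul Q (join Q S) a = join Q ((\<lambda>s. mul Q s a) ` S))"

definition locale_q :: "('a, 'b) stp_scheme \<Rightarrow> bool" where
  "locale_q Q \<longleftrightarrow> quantale Q
     \<and> (\<forall>a\<in>car Q. \<forall>b\<in>car Q. mul Q a b = meet Q a b)
     \<and> unit Q = topQ Q"

definition nc_spacetime :: "('a, 'b) stp_scheme \<Rightarrow> bool" where
  "nc_spacetime Q \<longleftrightarrow> quantale Q
     \<and> (\<forall>a\<in>car Q. nab Q a \<in> car Q)
     \<and> (\<forall>S\<subseteq>car Q. nab Q (join Q S) = join Q (nab Q ` S))
     \<and> (\<forall>a\<in>car Q. \<forall>b\<in>car Q. le Q (nab Q (mul Q a b)) (mul Q (nab Q a) (nab Q b)))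
     \<and> le Q (nab Q (unit Q)) (unit Q)"

definition spacetime :: "('a, 'b) stp_scheme \<Rightarrow> bool" where
  "spacetime Q \<longleftrightarrow> nc_spacetime Q \<and> locale_q Q"

definition impQ :: "('a, 'b) stp_scheme \<Rightarrow> 'a \<Rightarrow> 'a \<Rightarrow> 'a" where
  "impQ Q a c = join Q {b \<in> car Q. le Q (mul Q a (nab Q b)) c}"

fun eval :: "('a, 'b) stp_scheme \<Rightarrow> (nat \<Rightarrow> 'a) \<Rightarrow> fm \<Rightarrow> 'a" where
  "eval Q v (Var n) = v n"
| "eval Q v One = unit Q"
| "eval Q v Top = topQ Q"
| "eval Q v Bot = botQ Q"
| "eval Q v (And A B) = meet Q (eval Q v A) (eval Q v B)"
| "eval Q v (Or A B) = join Q {eval Q v A, eval Q v B}"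
| "eval Q v (Tens A B) = mul Q (eval Q v A) (eval Q v B)"
| "eval Q v (Imp A B) = impQ Q (eval Q v A) (eval Q v B)"
| "eval Q v (Nab A) = nab Q (eval Q v A)"

definition valid :: "('a, 'b) stp_scheme \<Rightarrow> fm list \<Rightarrow> fm \<Rightarrow> bool" where
  "valid Q \<Gamma> A \<longleftrightarrow> (\<forall>v. range v \<subseteq> car Q \<longrightarrow>
      le Q (foldr (\<lambda>g acc. mul Q (eval Q v g) acc) \<Gamma> (unit Q)) (eval Q v A))"

fun sat_scheme :: "('a, 'b) stp_scheme \<Rightarrow> scheme \<Rightarrow> bool" where
  "sat_scheme Q SN \<longleftrightarrow> nab Q (unit Q) = unit Q
     \<and> (\<forall>a\<in>car Q. \<forall>b\<in>car Q. nab Q (mul Q a b) = mul Q (nab Q a) (nab Q b))"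
| "sat_scheme Q SH \<longleftrightarrow> nab Q (unit Q) = unit Q
     \<and> nab Q (topQ Q) = topQ Q
     \<and> nab Q (botQ Q) = botQ Q
     \<and> (\<forall>a\<in>car Q. \<forall>b\<in>car Q. nab Q (mul Q a b) = mul Q (nab Q a) (nab Q b))
     \<and> (\<forall>a\<in>car Q. \<forall>b\<in>car Q. nab Q (meet Q a b) = meet Q (nab Q a) (nab Q b))
     \<and> (\<forall>a\<in>car Q. \<forall>b\<in>car Q. nab Q (join Q {a, b}) = join Q {nab Q a, nab Q b})
     \<and> (\<forall>a\<in>car Q. \<forall>b\<in>car Q. nab Q (impQ Q a b) = impQ Q (nab Q a) (nab Q b))"
| "sat_scheme Q SP \<longleftrightarrow> (\<forall>a\<in>car Q. le Q (nab Q a) a)"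
| "sat_scheme Q SF \<longleftrightarrow> (\<forall>a\<in>car Q. le Q a (nab Q a))"
| "sat_scheme Q SwF \<longleftrightarrow> (\<forall>a\<in>car Q. nab Q a = botQ Q \<longrightarrow> a = botQ Q)"

definition sat_schemes :: "('a, 'b) stp_scheme \<Rightarrow> scheme set \<Rightarrow> bool" where
  "sat_schemes Q R \<longleftrightarrow> (\<forall>r\<in>R. sat_scheme Q r)"

end

theory Submission
  imports Defs
begin

text \<open>
  The witness is the ideal completion of the Lindenbaum algebra, ordered by inclusion. The product
  of two ideals consists of everything below some \<open>A \<otimes> B\<close> with \<open>A\<close>, \<open>B\<close> in the factors, and is
  itself an ideal because \<open>\<otimes>\<close> is monotone and ideals are directed. Distributivity over arbitrary
  joins follows since preimages of ideals under \<open>A \<otimes> _\<close>, \<open>_ \<otimes> A\<close> and \<open>\<nabla>\<close>, which preserve finite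
  joins, are ideals again. Principal ideals are closed under all operations including the
  implication, so the canonical valuation sends \<open>A\<close> to the principal ideal of \<open>A\<close>.

  All schemes except \<open>H\<close> lift to ideals directly. Under \<open>H\<close>, the right adjoint \<open>1 \<rightarrow> _\<close> of \<open>\<nabla>\<close> is
  also its inverse: \<open>b \<le> 1 \<rightarrow> \<nabla>b \<le> \<nabla>1 \<rightarrow> \<nabla>b \<le> \<nabla>(1 \<rightarrow> b) \<le> b\<close>. Hence \<open>\<nabla>\<close> is an automorphism of
  the Lindenbaum algebra and induces one on ideals, which therefore preserves implications.
\<close>

section \<open>Derived rules: contexts as single formulas, and two adjunctions\<close>

abbreviation tensor :: "fm list \<Rightarrow> fm" where
  "tensor \<Gamma> \<equiv> foldr Tens \<Gamma> One"

text \<open>Both calculi are treated at once; the flag \<open>s\<close> is assumed true only where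
  the ideals are shown to form a locale.\<close>

context
  fixes R :: "scheme set" and s :: bool
begin

abbreviation (input) entails :: "fm list \<Rightarrow> fm \<Rightarrow> bool" (infix "\<turnstile>" 50) where
  "\<Gamma> \<turnstile> A \<equiv> derivable R s \<Gamma> A"

lemma cut_single: "\<Gamma> \<turnstile> A \<Longrightarrow> [A] \<turnstile> B \<Longrightarrow> \<Gamma> \<turnstile> B"
  using derivable.cut[of R s \<Gamma> A "[]" "[]" B] by simp

lemma tens_left: "[A, B] \<turnstile> C \<Longrightarrow> [Tens A B] \<turnstile> C"
  using derivable.tensL[of R s "[]" A B "[]" C] by simp

lemma tens_right: "[A, B] \<turnstile> Tens A B"
  using derivable.tensR[OF derivable.ax[of R s A] derivable.ax[of R s B]] by simp

lemma tens_left_iff: "[Tens A B] \<turnstile> C \<longleftrightarrow> [A, B] \<turnstile> C"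
  using tens_left cut_single tens_right by blast

lemma tens_mono: "[A] \<turnstile> A' \<Longrightarrow> [B] \<turnstile> B' \<Longrightarrow> [Tens A B] \<turnstile> Tens A' B'"
  using derivable.tensR[of R s "[A]" A' "[B]" B'] tens_left by simp

lemma or_left: "[A] \<turnstile> C \<Longrightarrow> [B] \<turnstile> C \<Longrightarrow> [Or A B] \<turnstile> C"
  using derivable.orL[of R s "[]" A "[]" C B] by simp

lemma or_right1: "[A] \<turnstile> Or A B"
  by (rule derivable.orR1[OF derivable.ax])

lemma or_right2: "[B] \<turnstile> Or A B"
  by (rule derivable.orR2[OF derivable.ax])

lemma bot_left: "[Bot] \<turnstile> A"
  using derivable.bot[of R s "[]" "[]" A] by simp

lemma entails_tensor: "\<Gamma> \<turnstile> tensor \<Gamma>"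
proof (induction \<Gamma>)
  case Nil
  show ?case by (simp add: derivable.one)
next
  case (Cons A \<Gamma>)
  show ?case using derivable.tensR[OF derivable.ax[of R s A] Cons] by simp
qed

text \<open>The prefix \<open>\<Pi>\<close> absorbs the head formula in the induction, after which
  \<open>tensL\<close> fuses it with the already folded tail. The innermost \<open>One\<close> comes
  from \<open>oneL\<close>.\<close>

lemma tensor_left: "\<Pi> @ \<Gamma> \<turnstile> A \<Longrightarrow> \<Pi> @ [tensor \<Gamma>] \<turnstile> A"
proof (induction \<Gamma> arbitrary: \<Pi>)
  case Nil
  then show ?case using derivable.oneL[of R s \<Pi> "[]" A] by simp
next
  case (Cons B \<Gamma>)
  then have "\<Pi> @ [B, tensor \<Gamma>] @ [] \<turnstile> A" using Cons.IH[of "\<Pi> @ [B]"] by simp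
  then show ?case using derivable.tensL by fastforce
qed

text \<open>Entailment between single formulas thus captures every sequent, so an algebra of
  formulas can decide them all.\<close>

lemma tensor_left_iff: "[tensor \<Gamma>] \<turnstile> A \<longleftrightarrow> \<Gamma> \<turnstile> A"
  using tensor_left[of "[]"] cut_single[OF entails_tensor] by auto

lemma tensor_single: "[tensor [A]] \<turnstile> A"
  using tensor_left_iff derivable.ax by blast

lemma single_tensor: "[A] \<turnstile> tensor [A]"
  by (rule entails_tensor)

text \<open>Residuation inside the calculus. \<open>impR\<close> gives one direction; for the other,
  \<open>nab\<close> is applied to the premise and the result is cut against the \<open>impL\<close>
  instance \<open>[A, Nab (Imp A C)] \<turnstile> C\<close>.\<close>

lemma imp_adjoint: "[A, Nab B] \<turnstile> C \<longleftrightarrow> [B] \<turnstile> Imp A C"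
proof
  assume "[A, Nab B] \<turnstile> C"
  then show "[B] \<turnstile> Imp A C" using derivable.impR[of R s A "[B]"] by simp
next
  assume "[B] \<turnstile> Imp A C"
  then have "[Nab B] \<turnstile> Nab (Imp A C)" by (rule derivable.nab)
  moreover have "[A] @ [Nab (Imp A C)] @ [] \<turnstile> C"
    using derivable.impL[OF derivable.ax[of R s A], of "[]" C "[]" C] derivable.ax by simp
  ultimately have "[A] @ [Nab B] @ [] \<turnstile> C" by (rule derivable.cut)
  then show "[A, Nab B] \<turnstile> C" by simp
qed

text \<open>Residuation at \<open>A = One\<close>: \<open>Nab\<close> is left adjoint to
  \<open>Imp One\<close>. This yields preservation of finite joins and, under \<open>H\<close>, the
  inverse of \<open>Nab\<close>.\<close>

lemma nab_adjoint: "[Nab B] \<turnstile> C \<longleftrightarrow> [B] \<turnstile> Imp One C"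
proof -
  have "[Nab B] \<turnstile> C \<longleftrightarrow> [One, Nab B] \<turnstile> C"
    using derivable.oneL[of R s "[]" "[Nab B]" C]
      derivable.cut[OF derivable.one, of R s "[]" "[Nab B]" C] by auto
  then show ?thesis by (simp add: imp_adjoint)
qed

section \<open>Ideals, their products, images and preimages\<close>

text \<open>An ideal is stored as the set of all contexts whose tensor lies in it.\<close>

definition ideal :: "fm list set \<Rightarrow> bool" where
  "ideal X \<longleftrightarrow> (\<forall>\<Gamma> A. \<Gamma> \<turnstile> A \<longrightarrow> [A] \<in> X \<longrightarrow> \<Gamma> \<in> X)
     \<and> (\<forall>\<Gamma>\<in>X. [tensor \<Gamma>] \<in> X)
     \<and> [Bot] \<in> X
     \<and> (\<forall>A B. [A] \<in> X \<longrightarrow> [B] \<in> X \<longrightarrow> [Or A B] \<in> X)"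

lemma
  assumes "ideal X"
  shows ideal_down: "\<Gamma> \<turnstile> A \<Longrightarrow> [A] \<in> X \<Longrightarrow> \<Gamma> \<in> X"
    and ideal_tensor: "\<Gamma> \<in> X \<Longrightarrow> [tensor \<Gamma>] \<in> X"
    and ideal_bot: "[Bot] \<in> X"
    and ideal_or: "[A] \<in> X \<Longrightarrow> [B] \<in> X \<Longrightarrow> [Or A B] \<in> X"
  using assms unfolding ideal_def by blast+

text \<open>An ideal contains \<open>\<Gamma>\<close> exactly if it contains
  \<open>[tensor \<Gamma>]\<close>, so it is determined by its one-formula contexts.\<close>

lemma ideal_subsetI:
  assumes "ideal X" "ideal Y" "\<And>A. [A] \<in> X \<Longrightarrow> [A] \<in> Y"
  shows "X \<subseteq> Y"
  using assms ideal_down ideal_tensor entails_tensor by blast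

definition principal :: "fm \<Rightarrow> fm list set" where
  "principal A = {\<Gamma>. \<Gamma> \<turnstile> A}"

definition prod_ideal :: "fm list set \<Rightarrow> fm list set \<Rightarrow> fm list set" where
  "prod_ideal X Y = {\<Gamma>. \<exists>A B. [A] \<in> X \<and> [B] \<in> Y \<and> \<Gamma> \<turnstile> Tens A B}"

definition nab_ideal :: "fm list set \<Rightarrow> fm list set" where
  "nab_ideal X = {\<Gamma>. \<exists>A. [A] \<in> X \<and> \<Gamma> \<turnstile> Nab A}"

text \<open>The tensor turns a context into a formula to which \<open>f\<close> applies. On
  \<open>[A]\<close> this gives \<open>f (Tens A One)\<close> instead of \<open>f A\<close>, which
  makes no difference for monotone \<open>f\<close>.\<close>

definition preimage :: "(fm \<Rightarrow> fm) \<Rightarrow> fm list set \<Rightarrow> fm list set" where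
  "preimage f Z = {\<Gamma>. [f (tensor \<Gamma>)] \<in> Z}"

lemma ideal_principal: "ideal (principal A)"
  unfolding ideal_def principal_def
  using cut_single tensor_left_iff bot_left or_left by blast

lemma ideal_Inter: "(\<And>X. X \<in> T \<Longrightarrow> ideal X) \<Longrightarrow> ideal (\<Inter>T)"
  unfolding ideal_def by blast

lemma ideal_prod:
  assumes X: "ideal X" and Y: "ideal Y"
  shows "ideal (prod_ideal X Y)"
  unfolding ideal_def
proof (intro conjI allI ballI impI)
  show "\<Gamma> \<in> prod_ideal X Y" if "\<Gamma> \<turnstile> A" "[A] \<in> prod_ideal X Y" for \<Gamma> A
    using that cut_single unfolding prod_ideal_def by blast
  show "[tensor \<Gamma>] \<in> prod_ideal X Y" if "\<Gamma> \<in> prod_ideal X Y" for \<Gamma>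
    using that tensor_left_iff unfolding prod_ideal_def by blast
  show "[Bot] \<in> prod_ideal X Y"
    using ideal_bot[OF X] ideal_bot[OF Y] bot_left unfolding prod_ideal_def by blast
  show "[Or A B] \<in> prod_ideal X Y" if A: "[A] \<in> prod_ideal X Y" and B: "[B] \<in> prod_ideal X Y" for A B
  proof -
    obtain C D where CD: "[C] \<in> X" "[D] \<in> Y" "[A] \<turnstile> Tens C D"
      using A unfolding prod_ideal_def by blast
    obtain E F where EF: "[E] \<in> X" "[F] \<in> Y" "[B] \<turnstile> Tens E F"
      using B unfolding prod_ideal_def by blast
    \<comment> \<open>Directedness of both factors: joining the witnesses componentwise gives one
      product above \<open>A\<close> and \<open>B\<close>.\<close>
    have "[A] \<turnstile> Tens (Or C E) (Or D F)"
      using cut_single[OF CD(3) tens_mono] or_right1 by blast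
    moreover have "[B] \<turnstile> Tens (Or C E) (Or D F)"
      using cut_single[OF EF(3) tens_mono] or_right2 by blast
    ultimately have "[Or A B] \<turnstile> Tens (Or C E) (Or D F)" by (rule or_left)
    then show ?thesis
      using ideal_or[OF X CD(1) EF(1)] ideal_or[OF Y CD(2) EF(2)] unfolding prod_ideal_def by blast
  qed
qed

lemma ideal_nab:
  assumes X: "ideal X"
  shows "ideal (nab_ideal X)"
  unfolding ideal_def
proof (intro conjI allI ballI impI)
  show "\<Gamma> \<in> nab_ideal X" if "\<Gamma> \<turnstile> A" "[A] \<in> nab_ideal X" for \<Gamma> A
    using that cut_single unfolding nab_ideal_def by blast
  show "[tensor \<Gamma>] \<in> nab_ideal X" if "\<Gamma> \<in> nab_ideal X" for \<Gamma>
    using that tensor_left_iff unfolding nab_ideal_def by blast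
  show "[Bot] \<in> nab_ideal X"
    using ideal_bot[OF X] bot_left unfolding nab_ideal_def by blast
  show "[Or A B] \<in> nab_ideal X" if A: "[A] \<in> nab_ideal X" and B: "[B] \<in> nab_ideal X" for A B
  proof -
    obtain C D where CD: "[C] \<in> X" "[A] \<turnstile> Nab C" "[D] \<in> X" "[B] \<turnstile> Nab D"
      using A B unfolding nab_ideal_def by blast
    have "[Or A B] \<turnstile> Nab (Or C D)"
      using or_left cut_single[OF CD(2) derivable.nab[OF or_right1]]
        cut_single[OF CD(4) derivable.nab[OF or_right2]] by blast
    then show ?thesis
      using ideal_or[OF X CD(1) CD(3)] unfolding nab_ideal_def by blast
  qed
qed

text \<open>Monotonicity pulls back downward closure, and preservation of finite joins pulls back
  closure under \<open>Bot\<close> and \<open>Or\<close>. The converses of \<open>bot\<close> and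
  \<open>or\<close> hold for every monotone \<open>f\<close>.\<close>

lemma ideal_preimage:
  assumes Z: "ideal Z"
    and mono: "\<And>A B. [A] \<turnstile> B \<Longrightarrow> [f A] \<turnstile> f B"
    and bot: "[f Bot] \<turnstile> Bot"
    and or: "\<And>A B. [f (Or A B)] \<turnstile> Or (f A) (f B)"
  shows "ideal (preimage f Z)"
    and "[A] \<in> preimage f Z \<longleftrightarrow> [f A] \<in> Z"
proof -
  have single: "[A] \<in> preimage f Z \<longleftrightarrow> [f A] \<in> Z" for A
    unfolding preimage_def
    using ideal_down[OF Z mono[OF tensor_single]] ideal_down[OF Z mono[OF single_tensor]] by blast
  then show "[A] \<in> preimage f Z \<longleftrightarrow> [f A] \<in> Z" .
  show "ideal (preimage f Z)"
    unfolding ideal_def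
  proof (intro conjI allI ballI impI)
    show "\<Gamma> \<in> preimage f Z" if "\<Gamma> \<turnstile> A" "[A] \<in> preimage f Z" for \<Gamma> A
    proof -
      have "[f (tensor \<Gamma>)] \<turnstile> f A" using that(1) mono tensor_left_iff by blast
      then show ?thesis using that(2) single ideal_down[OF Z] unfolding preimage_def by blast
    qed
    show "[tensor \<Gamma>] \<in> preimage f Z" if "\<Gamma> \<in> preimage f Z" for \<Gamma>
      using that unfolding single by (simp add: preimage_def)
    show "[Bot] \<in> preimage f Z"
      using ideal_down[OF Z bot ideal_bot[OF Z]] single by simp
    show "[Or A B] \<in> preimage f Z" if "[A] \<in> preimage f Z" "[B] \<in> preimage f Z" for A B
      using ideal_down[OF Z or ideal_or[OF Z]] that single by simp
  qed
qed

text \<open>The left rules for \<open>Bot\<close> and \<open>Or\<close> act inside a context, and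
  next to a side formula \<open>A\<close> this is distributivity of \<open>Tens A\<close> over
  finite joins.\<close>

lemma preimage_tens_left:
  assumes Z: "ideal Z"
  shows "ideal (preimage (Tens A) Z)" and "[B] \<in> preimage (Tens A) Z \<longleftrightarrow> [Tens A B] \<in> Z"
proof -
  have "[Tens A B] \<turnstile> Tens A C" if "[B] \<turnstile> C" for B C
    using that by (rule tens_mono[OF derivable.ax])
  moreover have "[Tens A Bot] \<turnstile> Bot"
    using derivable.bot[of R s "[A]" "[]"] tens_left by simp
  moreover have "[Tens A (Or B C)] \<turnstile> Or (Tens A B) (Tens A C)" for B C
    using derivable.orL[of R s "[A]" B "[]" _ C] or_right1 or_right2
    by (simp add: tens_left_iff[symmetric])
  ultimately show "ideal (preimage (Tens A) Z)" "[B] \<in> preimage (Tens A) Z \<longleftrightarrow> [Tens A B] \<in> Z"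
    using ideal_preimage[OF Z] by blast+
qed

lemma preimage_tens_right:
  assumes Z: "ideal Z"
  shows "ideal (preimage (\<lambda>B. Tens B A) Z)"
    and "[B] \<in> preimage (\<lambda>B. Tens B A) Z \<longleftrightarrow> [Tens B A] \<in> Z"
proof -
  have "[Tens B A] \<turnstile> Tens C A" if "[B] \<turnstile> C" for B C
    using that derivable.ax by (rule tens_mono)
  moreover have "[Tens Bot A] \<turnstile> Bot"
    using derivable.bot[of R s "[]" "[A]"] tens_left by simp
  moreover have "[Tens (Or B C) A] \<turnstile> Or (Tens B A) (Tens C A)" for B C
    using derivable.orL[of R s "[]" B "[A]" _ C] or_right1 or_right2
    by (simp add: tens_left_iff[symmetric])
  ultimately show "ideal (preimage (\<lambda>B. Tens B A) Z)"
    "[B] \<in> preimage (\<lambda>B. Tens B A) Z \<longleftrightarrow> [Tens B A] \<in> Z"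
    using ideal_preimage[OF Z, of "\<lambda>B. Tens B A"] by blast+
qed

text \<open>As a left adjoint, \<open>Nab\<close> preserves finite joins: \<open>nab_adjoint\<close>
  moves it to the right, where the left rules for \<open>Bot\<close> and \<open>Or\<close>
  apply.\<close>

lemma preimage_nab:
  assumes Z: "ideal Z"
  shows "ideal (preimage Nab Z)" and "[B] \<in> preimage Nab Z \<longleftrightarrow> [Nab B] \<in> Z"
proof -
  have "[Nab Bot] \<turnstile> Bot"
    using nab_adjoint bot_left by blast
  moreover have "[Nab (Or B C)] \<turnstile> Or (Nab B) (Nab C)" for B C
    using nab_adjoint or_left or_right1 or_right2 by blast
  ultimately show "ideal (preimage Nab Z)" "[B] \<in> preimage Nab Z \<longleftrightarrow> [Nab B] \<in> Z"
    using ideal_preimage[OF Z, of Nab] derivable.nab by blast+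
qed

lemma prod_memI: "[A] \<in> X \<Longrightarrow> [B] \<in> Y \<Longrightarrow> [Tens A B] \<in> prod_ideal X Y"
  unfolding prod_ideal_def using derivable.ax by blast

text \<open>The products \<open>Tens A B\<close> generate \<open>prod_ideal X Y\<close> by downward
  closure, so an inclusion into an ideal can be tested on them.\<close>

lemma prod_subset_iff:
  assumes "ideal Z"
  shows "prod_ideal X Y \<subseteq> Z \<longleftrightarrow> (\<forall>A B. [A] \<in> X \<longrightarrow> [B] \<in> Y \<longrightarrow> [Tens A B] \<in> Z)"
  using prod_memI ideal_down[OF assms] unfolding prod_ideal_def by blast

lemma nab_memI: "[A] \<in> X \<Longrightarrow> [Nab A] \<in> nab_ideal X"
  unfolding nab_ideal_def using derivable.ax by blast

lemma nab_subset_iff: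
  assumes "ideal Z"
  shows "nab_ideal X \<subseteq> Z \<longleftrightarrow> (\<forall>A. [A] \<in> X \<longrightarrow> [Nab A] \<in> Z)"
  using nab_memI ideal_down[OF assms] unfolding nab_ideal_def by blast

lemma prod_mono: "X \<subseteq> X' \<Longrightarrow> Y \<subseteq> Y' \<Longrightarrow> prod_ideal X Y \<subseteq> prod_ideal X' Y'"
  unfolding prod_ideal_def by blast

lemma nab_mono: "X \<subseteq> Y \<Longrightarrow> nab_ideal X \<subseteq> nab_ideal Y"
  unfolding nab_ideal_def by blast

lemma principal_subset_iff: "ideal Z \<Longrightarrow> principal A \<subseteq> Z \<longleftrightarrow> [A] \<in> Z"
  unfolding principal_def using ideal_down derivable.ax by blast

lemma mem_principal: "\<Gamma> \<in> principal A \<longleftrightarrow> \<Gamma> \<turnstile> A"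
  by (simp add: principal_def)

lemma prod_principal: "prod_ideal (principal A) (principal B) = principal (Tens A B)"
  unfolding prod_ideal_def principal_def
  using tens_mono cut_single derivable.ax by blast

lemma nab_principal: "nab_ideal (principal A) = principal (Nab A)"
  unfolding nab_ideal_def principal_def
  using derivable.nab cut_single derivable.ax by blast

section \<open>The complete lattice of ideals\<close>

definition canon :: "fm list set stp" where
  "canon = \<lparr>car = {X. ideal X}, le = (\<subseteq>), mul = prod_ideal, unit = principal One, nab = nab_ideal\<rparr>"

lemma canon_simps [simp]:
  "car canon = {X. ideal X}" "le canon = (\<subseteq>)" "mul canon = prod_ideal"
  "unit canon = principal One" "nab canon = nab_ideal"
  by (simp_all add: canon_def)

lemma join_eqI: "is_lub canon S X \<Longrightarrow> join canon S = X"
  unfolding join_def by (rule the_equality) (simp_all add: is_lub_def subset_antisym)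

lemma meet_eqI: "is_glb canon {X, Y} Z \<Longrightarrow> meet canon X Y = Z"
  unfolding meet_def by (rule the_equality) (simp_all add: is_glb_def subset_antisym)

text \<open>Ideals are closed under intersection, so the intersection of all upper bounds is the
  join. Later arguments rely on its universal property alone.\<close>

lemma ex_lub:
  assumes "S \<subseteq> car canon"
  shows "is_lub canon S (\<Inter>{Z. ideal Z \<and> (\<forall>X\<in>S. X \<subseteq> Z)})"
  unfolding is_lub_def using ideal_Inter[of "{Z. ideal Z \<and> (\<forall>X\<in>S. X \<subseteq> Z)}"] by auto

lemma is_lub_join: "S \<subseteq> car canon \<Longrightarrow> is_lub canon S (join canon S)"
  using ex_lub[of S] join_eqI[OF ex_lub[of S]] by simp

lemma
  assumes "S \<subseteq> car canon"
  shows ideal_join: "ideal (join canon S)"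
    and join_upper: "X \<in> S \<Longrightarrow> X \<subseteq> join canon S"
    and join_least: "ideal Z \<Longrightarrow> (\<And>X. X \<in> S \<Longrightarrow> X \<subseteq> Z) \<Longrightarrow> join canon S \<subseteq> Z"
  using is_lub_join[OF assms] unfolding is_lub_def by auto

lemma meet_canon: "ideal X \<Longrightarrow> ideal Y \<Longrightarrow> meet canon X Y = X \<inter> Y"
  by (rule meet_eqI) (use ideal_Inter[of "{X, Y}"] in \<open>auto simp: is_glb_def\<close>)

lemma principal_top: "principal Top = UNIV"
  by (simp add: principal_def derivable.top)

lemma topQ_canon: "topQ canon = UNIV"
  unfolding topQ_def
  by (rule join_eqI) (use ideal_principal[of Top] in \<open>auto simp: is_lub_def principal_top\<close>)

text \<open>Every ideal contains \<open>[Bot]\<close>, so the empty join is a principal ideal and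
  not the empty set.\<close>

lemma botQ_canon: "botQ canon = principal Bot"
  unfolding botQ_def
  by (rule join_eqI)
    (simp add: is_lub_def ideal_principal principal_subset_iff ideal_bot)

section \<open>Distributivity over joins and the monoid laws\<close>

lemma prod_join_left:
  assumes X: "ideal X" and S: "S \<subseteq> car canon"
  shows "prod_ideal X (join canon S) = join canon (prod_ideal X ` S)"
proof (rule sym, rule join_eqI, simp add: is_lub_def, intro conjI allI impI)
  show "ideal (prod_ideal X (join canon S))"
    by (rule ideal_prod[OF X ideal_join[OF S]])
  show "\<forall>Y\<in>S. prod_ideal X Y \<subseteq> prod_ideal X (join canon S)"
    using prod_mono join_upper[OF S] by blast
  fix Z assume Z: "ideal Z" and upper: "\<forall>Y\<in>S. prod_ideal X Y \<subseteq> Z"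
  \<comment> \<open>Transposing the claim: this preimage is an ideal above every member of
    \<open>S\<close>, so it lies above the join.\<close>
  have "join canon S \<subseteq> preimage (Tens A) Z" if "[A] \<in> X" for A
  proof (rule join_least[OF S preimage_tens_left(1)[OF Z]])
    fix Y assume Y: "Y \<in> S"
    then have "ideal Y" using S by auto
    then show "Y \<subseteq> preimage (Tens A) Z"
      using ideal_subsetI[OF _ preimage_tens_left(1)[OF Z]] preimage_tens_left(2)[OF Z]
        prod_memI[OF that] upper Y by blast
  qed
  then show "prod_ideal X (join canon S) \<subseteq> Z"
    using prod_subset_iff[OF Z] preimage_tens_left(2)[OF Z] by blast
qed

lemma prod_join_right:
  assumes X: "ideal X" and S: "S \<subseteq> car canon"
  shows "prod_ideal (join canon S) X = join canon ((\<lambda>Y. prod_ideal Y X) ` S)"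
proof (rule sym, rule join_eqI, simp add: is_lub_def, intro conjI allI impI)
  show "ideal (prod_ideal (join canon S) X)"
    by (rule ideal_prod[OF ideal_join[OF S] X])
  show "\<forall>Y\<in>S. prod_ideal Y X \<subseteq> prod_ideal (join canon S) X"
    using prod_mono join_upper[OF S] by blast
  fix Z assume Z: "ideal Z" and upper: "\<forall>Y\<in>S. prod_ideal Y X \<subseteq> Z"
  have "join canon S \<subseteq> preimage (\<lambda>B. Tens B A) Z" if "[A] \<in> X" for A
  proof (rule join_least[OF S preimage_tens_right(1)[OF Z]])
    fix Y assume Y: "Y \<in> S"
    then have "ideal Y" using S by auto
    then show "Y \<subseteq> preimage (\<lambda>B. Tens B A) Z"
      using ideal_subsetI[OF _ preimage_tens_right(1)[OF Z]] preimage_tens_right(2)[OF Z]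
        prod_memI[OF _ that] upper Y by blast
  qed
  then show "prod_ideal (join canon S) X \<subseteq> Z"
    using prod_subset_iff[OF Z] preimage_tens_right(2)[OF Z] by blast
qed

lemma nab_join:
  assumes S: "S \<subseteq> car canon"
  shows "nab_ideal (join canon S) = join canon (nab_ideal ` S)"
proof (rule sym, rule join_eqI, simp add: is_lub_def, intro conjI allI impI)
  show "ideal (nab_ideal (join canon S))"
    by (rule ideal_nab[OF ideal_join[OF S]])
  show "\<forall>Y\<in>S. nab_ideal Y \<subseteq> nab_ideal (join canon S)"
    using nab_mono join_upper[OF S] by blast
  fix Z assume Z: "ideal Z" and upper: "\<forall>Y\<in>S. nab_ideal Y \<subseteq> Z"
  have "join canon S \<subseteq> preimage Nab Z"
  proof (rule join_least[OF S preimage_nab(1)[OF Z]])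
    fix Y assume Y: "Y \<in> S"
    then have "ideal Y" using S by auto
    then show "Y \<subseteq> preimage Nab Z"
      using ideal_subsetI[OF _ preimage_nab(1)[OF Z]] preimage_nab(2)[OF Z]
        nab_memI upper Y by blast
  qed
  then show "nab_ideal (join canon S) \<subseteq> Z"
    using nab_subset_iff[OF Z] preimage_nab(2)[OF Z] by blast
qed

lemma tens_assoc: "[Tens (Tens A B) C] \<turnstile> Tens A (Tens B C)" "[Tens A (Tens B C)] \<turnstile> Tens (Tens A B) C"
proof -
  have "[A, B, C] \<turnstile> Tens A (Tens B C)"
    using derivable.tensR[OF derivable.ax[of R s A] tens_right] by simp
  then show "[Tens (Tens A B) C] \<turnstile> Tens A (Tens B C)"
    using derivable.tensL[of R s "[]" A B "[C]"] tens_left by simp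
  have "[A, B, C] \<turnstile> Tens (Tens A B) C"
    using derivable.tensR[OF tens_right derivable.ax[of R s C]] by simp
  then show "[Tens A (Tens B C)] \<turnstile> Tens (Tens A B) C"
    using derivable.tensL[of R s "[A]" B C "[]"] tens_left by simp
qed

lemma prod_assoc:
  "prod_ideal (prod_ideal X Y) Z = prod_ideal X (prod_ideal Y Z)"
proof (intro subset_antisym subsetI)
  fix \<Gamma> assume "\<Gamma> \<in> prod_ideal (prod_ideal X Y) Z"
  then obtain A B C D where *: "[A] \<in> X" "[B] \<in> Y" "[C] \<in> Z" "[D] \<turnstile> Tens A B" "\<Gamma> \<turnstile> Tens D C"
    unfolding prod_ideal_def by blast
  have "\<Gamma> \<turnstile> Tens A (Tens B C)"
    using cut_single[OF cut_single[OF *(5) tens_mono[OF *(4) derivable.ax]] tens_assoc(1)] .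
  then show "\<Gamma> \<in> prod_ideal X (prod_ideal Y Z)"
    using *(1) prod_memI[OF *(2,3)] unfolding prod_ideal_def by blast
next
  fix \<Gamma> assume "\<Gamma> \<in> prod_ideal X (prod_ideal Y Z)"
  then obtain A B C D where *: "[A] \<in> X" "[B] \<in> Y" "[C] \<in> Z" "[D] \<turnstile> Tens B C" "\<Gamma> \<turnstile> Tens A D"
    unfolding prod_ideal_def by blast
  have "\<Gamma> \<turnstile> Tens (Tens A B) C"
    using cut_single[OF cut_single[OF *(5) tens_mono[OF derivable.ax *(4)]] tens_assoc(2)] .
  then show "\<Gamma> \<in> prod_ideal (prod_ideal X Y) Z"
    using *(3) prod_memI[OF *(1,2)] unfolding prod_ideal_def by blast
qed

text \<open>A factor below \<open>One\<close> can be replaced by \<open>One\<close> and then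
  deleted, which gives one inclusion; inserting a factor \<open>One\<close> gives the other.\<close>

lemma
  assumes X: "ideal X"
  shows prod_unit_left: "prod_ideal (principal One) X = X"
    and prod_unit_right: "prod_ideal X (principal One) = X"
proof -
  have one: "ideal (principal One)" "[One] \<in> principal One"
    by (simp_all add: ideal_principal mem_principal derivable.ax)
  have left: "[Tens B A] \<turnstile> A" if "[B] \<turnstile> One" for A B
    using cut_single[OF tens_mono[OF that derivable.ax]]
      derivable.oneL[of R s "[]" "[A]" A] derivable.ax tens_left_iff by simp
  have right: "[Tens A B] \<turnstile> A" if "[B] \<turnstile> One" for A B
    using cut_single[OF tens_mono[OF derivable.ax that]]
      derivable.oneL[of R s "[A]" "[]" A] derivable.ax tens_left_iff by simp
  have left': "[A] \<turnstile> Tens One A" for A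
    using derivable.tensR[OF derivable.one derivable.ax[of R s A]] by simp
  have right': "[A] \<turnstile> Tens A One" for A
    using derivable.tensR[OF derivable.ax[of R s A] derivable.one] by simp
  show "prod_ideal (principal One) X = X"
  proof (rule subset_antisym)
    show "prod_ideal (principal One) X \<subseteq> X"
      unfolding prod_subset_iff[OF X] mem_principal using ideal_down[OF X left] by blast
    show "X \<subseteq> prod_ideal (principal One) X"
      using ideal_subsetI[OF X ideal_prod[OF one(1) X]]
        ideal_down[OF ideal_prod[OF one(1) X] left'] prod_memI[OF one(2)] by blast
  qed
  show "prod_ideal X (principal One) = X"
  proof (rule subset_antisym)
    show "prod_ideal X (principal One) \<subseteq> X"
      unfolding prod_subset_iff[OF X] mem_principal using ideal_down[OF X right] by blast
    show "X \<subseteq> prod_ideal X (principal One)"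
      using ideal_subsetI[OF X ideal_prod[OF X one(1)]]
        ideal_down[OF ideal_prod[OF X one(1)] right'] prod_memI[OF _ one(2)] by blast
  qed
qed

lemma quantale_canon: "quantale canon"
  unfolding quantale_def
  using ex_lub prod_join_left prod_join_right
  by (auto simp: ideal_principal ideal_prod prod_assoc prod_unit_left prod_unit_right
      dest: prod_mono[OF _ subset_refl] prod_mono[OF subset_refl])

section \<open>The oplax modality and its implication\<close>

lemma nab_prod_oplax:
  assumes X: "ideal X" and Y: "ideal Y"
  shows "nab_ideal (prod_ideal X Y) \<subseteq> prod_ideal (nab_ideal X) (nab_ideal Y)" (is "_ \<subseteq> ?P")
proof -
  have P: "ideal ?P" using X Y ideal_nab ideal_prod by blast
  have "[Nab C] \<in> ?P" if C: "[C] \<in> prod_ideal X Y" for C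
  proof -
    obtain A B where AB: "[A] \<in> X" "[B] \<in> Y" "[C] \<turnstile> Tens A B"
      using C unfolding prod_ideal_def by blast
    have "[Nab C] \<turnstile> Tens (Nab A) (Nab B)"
      using cut_single[OF derivable.nab[OF AB(3)] derivable.oplax[OF tens_right]] .
    then show ?thesis
      using ideal_down[OF P] prod_memI nab_memI AB by blast
  qed
  then show ?thesis using nab_subset_iff[OF P] by blast
qed

lemma nc_spacetime_canon: "nc_spacetime canon"
  unfolding nc_spacetime_def
  using quantale_canon nab_join nab_prod_oplax
  by (auto simp: ideal_nab nab_principal ideal_principal principal_subset_iff mem_principal
      derivable.nabone in_mono)

text \<open>\<open>impQ\<close> is the join of all solutions \<open>W\<close> of
  \<open>prod_ideal X (nab_ideal W) \<subseteq> Z\<close>. Product and modality preserve joins, so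
  this join is itself a solution, hence the greatest.\<close>

lemma le_impQ_iff:
  assumes X: "ideal X" and Y: "ideal Y" and Z: "ideal Z"
  shows "Y \<subseteq> impQ canon X Z \<longleftrightarrow> prod_ideal X (nab_ideal Y) \<subseteq> Z"
proof -
  define T where "T = {W \<in> car canon. prod_ideal X (nab_ideal W) \<subseteq> Z}"
  have T: "T \<subseteq> car canon" by (auto simp: T_def)
  have nT: "nab_ideal ` T \<subseteq> car canon" using T by (auto simp: ideal_nab)
  have pT: "prod_ideal X ` nab_ideal ` T \<subseteq> car canon" using nT X by (auto simp: ideal_prod)
  have imp: "impQ canon X Z = join canon T" by (simp add: impQ_def T_def)
  have "prod_ideal X (nab_ideal (join canon T)) = join canon (prod_ideal X ` nab_ideal ` T)"
    by (simp only: nab_join[OF T] prod_join_left[OF X nT])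
  also have "\<dots> \<subseteq> Z"
    by (rule join_least[OF pT Z]) (auto simp: T_def)
  finally have "prod_ideal X (nab_ideal (impQ canon X Z)) \<subseteq> Z" by (simp add: imp)
  then have "prod_ideal X (nab_ideal Y) \<subseteq> Z" if "Y \<subseteq> impQ canon X Z"
    using prod_mono[OF subset_refl nab_mono[OF that]] by blast
  moreover have "Y \<subseteq> impQ canon X Z" if "prod_ideal X (nab_ideal Y) \<subseteq> Z"
    unfolding imp by (rule join_upper[OF T]) (simp add: T_def Y that)
  ultimately show ?thesis by blast
qed

lemma ideal_impQ: "ideal (impQ canon X Z)"
  unfolding impQ_def by (rule ideal_join) auto

text \<open>Residuation of ideals (\<open>le_impQ_iff\<close>) is matched with residuation of
  formulas (\<open>imp_adjoint\<close>). An element \<open>[B]\<close> of the implication is handled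
  through the principal ideal of \<open>B\<close>.\<close>

lemma impQ_principal: "impQ canon (principal A) (principal C) = principal (Imp A C)"
proof (rule subset_antisym)
  have "prod_ideal (principal A) (nab_ideal (principal (Imp A C))) \<subseteq> principal C"
    using tens_left imp_adjoint derivable.ax
    by (auto simp: nab_principal prod_principal principal_subset_iff ideal_principal mem_principal)
  then show "principal (Imp A C) \<subseteq> impQ canon (principal A) (principal C)"
    by (simp add: le_impQ_iff ideal_principal)
  show "impQ canon (principal A) (principal C) \<subseteq> principal (Imp A C)"
  proof (rule ideal_subsetI[OF ideal_impQ ideal_principal])
    fix B assume "[B] \<in> impQ canon (principal A) (principal C)"
    then have "principal B \<subseteq> impQ canon (principal A) (principal C)"
      by (simp add: principal_subset_iff ideal_impQ)
    then have "[Tens A (Nab B)] \<turnstile> C"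
      by (simp add: le_impQ_iff ideal_principal nab_principal prod_principal principal_subset_iff
          mem_principal)
    then show "[B] \<in> principal (Imp A C)"
      by (simp add: tens_left_iff imp_adjoint mem_principal)
  qed
qed

section \<open>Principal ideals and the canonical valuation\<close>

lemma join_principal: "join canon {principal A, principal B} = principal (Or A B)"
  by (rule join_eqI)
    (simp add: is_lub_def ideal_principal principal_subset_iff mem_principal ideal_or
      or_right1 or_right2)

lemma meet_principal: "meet canon (principal A) (principal B) = principal (And A B)"
proof -
  have "[And A B] \<turnstile> A" "[And A B] \<turnstile> B"
    using derivable.andL1[of R s "[]" A "[]" A B] derivable.andL2[of R s "[]" B "[]" B A]
      derivable.ax by simp_all
  then have "principal A \<inter> principal B = principal (And A B)"
    unfolding principal_def using derivable.andR cut_single by blast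
  then show ?thesis by (simp add: meet_canon ideal_principal)
qed

lemma eval_canon: "eval canon (\<lambda>n. principal (Var n)) A = principal A"
  by (induction A)
    (simp_all add: topQ_canon principal_top botQ_canon meet_principal join_principal
      prod_principal impQ_principal nab_principal)

text \<open>Validity is used only at the canonical valuation. There it is an inclusion of principal
  ideals, that is, an entailment from \<open>tensor \<Gamma>\<close> to \<open>A\<close>.\<close>

lemma canon_complete:
  assumes "valid canon \<Gamma> A"
  shows "\<Gamma> \<turnstile> A"
proof -
  have "foldr (\<lambda>B. prod_ideal (principal B)) \<Gamma> (principal One) = principal (tensor \<Gamma>)"
    by (induction \<Gamma>) (simp_all add: prod_principal)
  moreover have "range (\<lambda>n. principal (Var n)) \<subseteq> car canon"
    by (auto simp: ideal_principal)
  ultimately have "principal (tensor \<Gamma>) \<subseteq> principal A"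
    using assms[unfolded valid_def, rule_format, of "\<lambda>n. principal (Var n)"]
    by (simp add: eval_canon)
  then show ?thesis
    by (simp add: principal_subset_iff ideal_principal mem_principal tensor_left_iff)
qed

section \<open>The scheme \<open>N\<close>\<close>

lemma rule_N:
  assumes "SN \<in> R \<or> SH \<in> R" and "\<Gamma> \<turnstile> A"
  shows "map Nab \<Gamma> \<turnstile> Nab A"
  \<comment> \<open>Scheme \<open>H\<close> with an empty list of implications is scheme
    \<open>N\<close>.\<close>
  using assms derivable.ruleN[of R s \<Gamma> A] derivable.ruleH[of R s \<Gamma> "[]" A] by auto

lemma sat_SN:
  assumes R: "SN \<in> R \<or> SH \<in> R"
  shows "sat_scheme canon SN"
proof -
  have "principal (Nab One) = principal One"
    using rule_N[OF R derivable.one] derivable.nabone tensor_left_iff[of "[]"]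
    by (intro subset_antisym)
      (simp_all add: principal_subset_iff ideal_principal mem_principal)
  moreover have "prod_ideal (nab_ideal X) (nab_ideal Y) \<subseteq> nab_ideal (prod_ideal X Y)"
    (is "_ \<subseteq> ?N") if "ideal X" "ideal Y" for X Y
  proof -
    have N: "ideal ?N" using that ideal_prod ideal_nab by blast
    have "[Tens A B] \<in> ?N" if AB: "[A] \<in> nab_ideal X" "[B] \<in> nab_ideal Y" for A B
    proof -
      obtain C D where CD: "[C] \<in> X" "[A] \<turnstile> Nab C" "[D] \<in> Y" "[B] \<turnstile> Nab D"
        using AB unfolding nab_ideal_def by blast
      \<comment> \<open>\<open>N\<close> applied to \<open>[C, D] \<turnstile> Tens C D\<close>
        gives the converse of the oplax law.\<close>
      have "[Tens (Nab C) (Nab D)] \<turnstile> Nab (Tens C D)"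
        using rule_N[OF R tens_right] tens_left by simp
      then have "[Tens A B] \<turnstile> Nab (Tens C D)"
        using cut_single[OF tens_mono[OF CD(2) CD(4)]] by blast
      then show ?thesis using ideal_down[OF N] nab_memI prod_memI CD(1,3) by blast
    qed
    then show ?thesis using prod_subset_iff[OF N] by blast
  qed
  ultimately show ?thesis
    using nab_prod_oplax by (simp add: nab_principal subset_antisym)
qed

section \<open>The scheme \<open>H\<close>: invertibility of the modality\<close>

lemma
  assumes H: "SH \<in> R"
  shows nab_reflects: "[Nab A] \<turnstile> Nab B \<Longrightarrow> [A] \<turnstile> B"
    and nab_imp_one: "[A] \<turnstile> Nab (Imp One A)"
proof -
  \<comment> \<open>\<open>H\<close> with the single pair \<open>(One, B)\<close> yields the claim
    with antecedent \<open>Nab One\<close>; since implication is antitone there,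
    \<open>nabone\<close> supplies the missing entailment.\<close>
  have shift: "[Imp One (Nab B)] \<turnstile> Nab (Imp One B)" for B
  proof -
    have "[Imp (Nab One) (Nab B)] \<turnstile> Nab (Imp One B)"
      using derivable.ruleH[OF H, of s "[]" "[(One, B)]" "Imp One B"] derivable.ax by simp
    moreover have "[Imp One (Nab B)] \<turnstile> Imp (Nab One) (Nab B)"
    proof -
      have "[] @ [One] @ [Nab (Imp One (Nab B))] \<turnstile> Nab B"
        using imp_adjoint derivable.ax by simp
      then have "[] @ [Nab One] @ [Nab (Imp One (Nab B))] \<turnstile> Nab B"
        by (rule derivable.cut[OF derivable.nabone])
      then show ?thesis using imp_adjoint by simp
    qed
    ultimately show ?thesis using cut_single by blast
  qed
  show "[A] \<turnstile> Nab (Imp One A)" for A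
    using cut_single[OF _ shift] nab_adjoint derivable.ax by blast
  \<comment> \<open>Transpose to \<open>[A] \<turnstile> Imp One (Nab B)\<close>, apply
    \<open>shift\<close>, and finish with the counit
    \<open>[Nab (Imp One B)] \<turnstile> B\<close>.\<close>
  show "[A] \<turnstile> B" if "[Nab A] \<turnstile> Nab B"
    using that cut_single[OF cut_single[OF _ shift]] nab_adjoint derivable.ax by blast
qed

lemma nab_subset_cancel:
  assumes "SH \<in> R" and X: "ideal X" and Y: "ideal Y" and sub: "nab_ideal X \<subseteq> nab_ideal Y"
  shows "X \<subseteq> Y"
proof (rule ideal_subsetI[OF X Y])
  fix A assume "[A] \<in> X"
  then have "[Nab A] \<in> nab_ideal Y" using nab_memI sub by blast
  then show "[A] \<in> Y"
    using nab_reflects[OF assms(1)] ideal_down[OF Y] unfolding nab_ideal_def by blast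
qed

text \<open>The preimage works: for \<open>[A]\<close> in \<open>Y\<close> it contains
  \<open>[Imp One A]\<close> by the counit, and \<open>A\<close> lies below
  \<open>Nab (Imp One A)\<close>.\<close>

lemma nab_surj:
  assumes "SH \<in> R" and Y: "ideal Y"
  obtains X where "ideal X" "nab_ideal X = Y"
proof
  let ?X = "preimage Nab Y"
  show X: "ideal ?X" by (rule preimage_nab(1)[OF Y])
  show "nab_ideal ?X = Y"
  proof (rule subset_antisym)
    show "nab_ideal ?X \<subseteq> Y"
      by (simp add: nab_subset_iff[OF Y] preimage_nab(2)[OF Y])
    show "Y \<subseteq> nab_ideal ?X"
    proof (rule ideal_subsetI[OF Y ideal_nab[OF X]])
      fix A assume "[A] \<in> Y"
      then have "[Imp One A] \<in> ?X"
        unfolding preimage_nab(2)[OF Y] using ideal_down[OF Y] nab_adjoint derivable.ax by blast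
      then show "[A] \<in> nab_ideal ?X"
        using nab_imp_one[OF assms(1)] unfolding nab_ideal_def by blast
    qed
  qed
qed

lemma sat_SH:
  assumes H: "SH \<in> R"
  shows "sat_scheme canon SH"
proof -
  have N: "nab_ideal (prod_ideal X Y) = prod_ideal (nab_ideal X) (nab_ideal Y)"
    if "ideal X" "ideal Y" for X Y
    using sat_SN H that by simp
  \<comment> \<open>Some ideal is mapped onto \<open>UNIV\<close>, so by monotonicity
    \<open>UNIV\<close> is too.\<close>
  have top: "nab_ideal UNIV = UNIV"
    using nab_surj[OF H ideal_principal[of Top]] nab_mono[OF subset_UNIV]
    unfolding principal_top by (metis top.extremum_uniqueI)
  have bot: "nab_ideal (principal Bot) = principal Bot"
    using nab_join[of "{}"] botQ_canon unfolding botQ_def by simp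
  have meet: "nab_ideal (X \<inter> Y) = nab_ideal X \<inter> nab_ideal Y"
    if X: "ideal X" and Y: "ideal Y" for X Y
  proof (rule subset_antisym)
    show "nab_ideal (X \<inter> Y) \<subseteq> nab_ideal X \<inter> nab_ideal Y"
      by (simp add: nab_mono)
    have "ideal (nab_ideal X \<inter> nab_ideal Y)"
      using ideal_Inter[of "{nab_ideal X, nab_ideal Y}"] X Y ideal_nab by auto
    \<comment> \<open>An ideal below both images is pulled back along the automorphism and compared
      there by cancellation.\<close>
    then obtain W where W: "ideal W" "nab_ideal W = nab_ideal X \<inter> nab_ideal Y"
      using nab_surj[OF H] by blast
    then have "W \<subseteq> X \<inter> Y"
      using nab_subset_cancel[OF H W(1)] X Y by simp
    then show "nab_ideal X \<inter> nab_ideal Y \<subseteq> nab_ideal (X \<inter> Y)"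
      using nab_mono W(2) by blast
  qed
  have imp: "nab_ideal (impQ canon X Y) = impQ canon (nab_ideal X) (nab_ideal Y)"
    if X: "ideal X" and Y: "ideal Y" for X Y
  proof (rule subset_antisym)
    note nX = ideal_nab[OF X] and nY = ideal_nab[OF Y]
    have "prod_ideal X (nab_ideal (impQ canon X Y)) \<subseteq> Y"
      using le_impQ_iff[OF X ideal_impQ Y] by blast
    then have "prod_ideal (nab_ideal X) (nab_ideal (nab_ideal (impQ canon X Y))) \<subseteq> nab_ideal Y"
      using nab_mono by (simp add: N[symmetric] X ideal_nab ideal_impQ)
    then show "nab_ideal (impQ canon X Y) \<subseteq> impQ canon (nab_ideal X) (nab_ideal Y)"
      using le_impQ_iff[OF nX ideal_nab[OF ideal_impQ] nY] by blast
    \<comment> \<open>The implication of the images is pulled back to \<open>W\<close>. Residuation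
      and \<open>N\<close> put one modality around the whole product, where it can be
      cancelled.\<close>
    obtain W where W: "ideal W" "nab_ideal W = impQ canon (nab_ideal X) (nab_ideal Y)"
      using nab_surj[OF H ideal_impQ] by blast
    then have "nab_ideal (prod_ideal X (nab_ideal W)) \<subseteq> nab_ideal Y"
      using le_impQ_iff[OF nX ideal_nab[OF W(1)] nY] N[OF X ideal_nab[OF W(1)]] by simp
    then have "prod_ideal X (nab_ideal W) \<subseteq> Y"
      by (rule nab_subset_cancel[OF H ideal_prod[OF X ideal_nab[OF W(1)]] Y])
    then have "W \<subseteq> impQ canon X Y" using le_impQ_iff[OF X W(1) Y] by blast
    then show "impQ canon (nab_ideal X) (nab_ideal Y) \<subseteq> nab_ideal (impQ canon X Y)"
      using nab_mono W(2) by blast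
  qed
  have unit: "nab_ideal (principal One) = principal One" using sat_SN H by simp
  have "meet canon (nab_ideal X) (nab_ideal Y) = nab_ideal X \<inter> nab_ideal Y"
    if "ideal X" "ideal Y" for X Y using that by (simp add: meet_canon ideal_nab)
  moreover have "nab_ideal (join canon {X, Y}) = join canon {nab_ideal X, nab_ideal Y}"
    if "ideal X" "ideal Y" for X Y using that nab_join[of "{X, Y}"] by simp
  ultimately show ?thesis
    by (simp add: unit N topQ_canon top botQ_canon bot meet_canon meet imp)
qed

section \<open>The schemes \<open>P\<close>, \<open>F\<close> and \<open>wF\<close>\<close>

lemma sat_SP:
  assumes "SP \<in> R"
  shows "sat_scheme canon SP"
  using ideal_down[OF _ derivable.ruleP[OF assms derivable.ax]] by (simp add: nab_subset_iff)

lemma sat_SF: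
  assumes "SF \<in> R"
  shows "sat_scheme canon SF"
proof -
  have "X \<subseteq> nab_ideal X" if X: "ideal X" for X
    using ideal_subsetI[OF X ideal_nab[OF X]] ideal_down[OF ideal_nab[OF X]] nab_memI
      derivable.ruleF[OF assms derivable.ax] by blast
  then show ?thesis by simp
qed

lemma sat_SwF:
  assumes "SwF \<in> R"
  shows "sat_scheme canon SwF"
proof -
  have "X = principal Bot" if X: "ideal X" and eq: "nab_ideal X = principal Bot" for X
  proof (rule subset_antisym)
    have "[A] \<turnstile> Bot" if "[A] \<in> X" for A
      using derivable.rulewF[OF assms] nab_memI[OF that] eq by (simp add: mem_principal)
    then show "X \<subseteq> principal Bot"
      using ideal_subsetI[OF X ideal_principal] mem_principal by blast
    show "principal Bot \<subseteq> X"
      by (simp add: principal_subset_iff X ideal_bot)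
  qed
  then show ?thesis by (simp add: botQ_canon)
qed

lemma sat_schemes_canon: "sat_schemes canon R"
  unfolding sat_schemes_def
proof
  fix r assume "r \<in> R"
  then show "sat_scheme canon r"
    by (cases r) (metis sat_SN sat_SH sat_SP sat_SF sat_SwF)+
qed

section \<open>Structural rules and the locale of ideals\<close>

lemma spacetime_canon:
  assumes s: s
  shows "spacetime canon"
proof -
  have fst: "[A, B] \<turnstile> A" and snd: "[A, B] \<turnstile> B" for A B
    using derivable.weak[OF s, of R "[A]" "[]" A B] derivable.weak[OF s, of R "[]" "[B]" B A]
      derivable.ax by simp_all
  have diag: "[A] \<turnstile> Tens A A" for A
    using derivable.contr[OF s, of R "[]" A "[]"] tens_right by simp
  \<comment> \<open>Weakening projects a product to its factors, and contraction maps a common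
    element to its square.\<close>
  have "prod_ideal X Y = X \<inter> Y" if X: "ideal X" and Y: "ideal Y" for X Y
  proof (rule subset_antisym)
    show "prod_ideal X Y \<subseteq> X \<inter> Y"
      using ideal_down[OF X tens_left[OF fst]] ideal_down[OF Y tens_left[OF snd]]
      by (simp add: prod_subset_iff[OF X] prod_subset_iff[OF Y])
    have I: "ideal (X \<inter> Y)" using ideal_Inter[of "{X, Y}"] X Y by auto
    show "X \<inter> Y \<subseteq> prod_ideal X Y"
      using ideal_subsetI[OF I ideal_prod[OF X Y]] ideal_down[OF ideal_prod[OF X Y] diag]
        prod_memI by blast
  qed
  moreover have "principal One = UNIV"
  proof -
    have "\<Gamma> \<turnstile> One" for \<Gamma>
    proof (induction \<Gamma>)
      case Nil
      show ?case by (rule derivable.one)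
    next
      case (Cons A \<Gamma>)
      then show ?case using derivable.weak[OF s, of R "[]" \<Gamma> One A] by simp
    qed
    then show ?thesis by (auto simp: mem_principal)
  qed
  ultimately show ?thesis
    by (simp add: spacetime_def nc_spacetime_canon locale_q_def quantale_canon meet_canon topQ_canon)
qed

end

theorem theorem7p12:
  fixes R :: "scheme set"
  shows "(\<exists>S :: fm list set stp. nc_spacetime S \<and> sat_schemes S R
            \<and> (\<forall>\<Gamma> A. valid S \<Gamma> A \<longrightarrow> derivable R False \<Gamma> A))
       \<and> (\<exists>S :: fm list set stp. spacetime S \<and> sat_schemes S R
            \<and> (\<forall>\<Gamma> A. valid S \<Gamma> A \<longrightarrow> derivable R True \<Gamma> A))"
  \<comment> \<open>One construction serves both claims, instantiated without and with the
    structural rules.\<close>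
  by (intro conjI exI[of _ "canon R False"] exI[of _ "canon R True"] allI impI nc_spacetime_canon
      spacetime_canon sat_schemes_canon TrueI; erule canon_complete)

end
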